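(* Let $X$ be a real Banach space that is uniformly convex (or finite dimensional and strictly convex) and let $X^*$ be strictly convex. Let $A\subset X$ be nonempty, let $f:X\to\mathbb{R}$ be Lipschitz continuous on a neighborhood of $A$ with $0\notin\partial f(A)$, and let $\tilde a$ be the unique element of $\partial f(A)$ with $\|\tilde a\|=\min_{a\in\partial f(A)}\|a\|$. Then for any $\delta\in\,]0,1[$ there is some $\tau>0$ such that for every $a'\in\partial f(A)$ with $$\|a'\|\le\min_{a\in\partial f(A)}\|a\|+\tau\quad(=\|\tilde a\|+\tau)$$ the unique $h'\in X$ satisfying $$\langle a',h'\rangle=-\|a'\|\quad\text{with}\quad\|h'\|=1$$ is a descent direction of $f$ on $A$ with $$\Big(\max_{a\in\partial f(A)}\langle a,h'\rangle=\Big)\quad f^0(A;h')<-\delta\|\tilde a\|.$$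
   Context: $X^*$ is the dual of $X$ (with dual norm) and $\langle\cdot,\cdot\rangle$ the duality pairing; a space is called strictly (uniformly) convex if its norm is. For $f$ Lipschitz near $x$, Clarke's generalized directional derivative is $f^0(x;h)=\limsup_{y\to x,\,t\downarrow 0}\frac{f(y+th)-f(y)}{t}$ and Clarke's generalized gradient is $\partial f(x)=\{a\in X^*\mid\langle a,h\rangle\le f^0(x;h)\ \forall h\in X\}$. For nonempty $A\subset X$, the gradient of $f$ on $A$ is $\partial f(A):=\overline{\operatorname{conv}}^*\bigcup_{y\in A}\partial f(y)$ (the weak$^*$ closure of the convex hull), and the directional derivative of $f$ on $A$ in direction $h\in X$ is $f^0(A;h):=\sup_{y\in A}f^0(y;h)$. An element $h\in X$ is a descent direction of $f$ on $A$ if $f^0(A;h)<0$. (Uniformly convex spaces are reflexive, and under the stated hypotheses $\tilde a$ exists and is unique.) A neighborhood of $A$ is a set containing an open set that contains $A$. *)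

theory Defs
  imports "HOL-Analysis.Analysis"
begin

text \<open>The following are properties of the norm of a type, hence the type token as argument.\<close>

definition strictly_convex_space :: "'a::real_normed_vector itself \<Rightarrow> bool" where
  "strictly_convex_space _ \<longleftrightarrow>
     (\<forall>(x::'a) y t. norm x = 1 \<longrightarrow> norm y = 1 \<longrightarrow> x \<noteq> y \<longrightarrow> 0 < t \<longrightarrow> t < 1 \<longrightarrow>
        norm ((1 - t) *\<^sub>R x + t *\<^sub>R y) < 1)"

definition uniformly_convex_space :: "'a::real_normed_vector itself \<Rightarrow> bool" where
  "uniformly_convex_space _ \<longleftrightarrow>
     (\<forall>\<epsilon>>0. \<exists>\<delta>>0. \<forall>(x::'a) y. norm x = 1 \<longrightarrow> norm y = 1 \<longrightarrow> norm (x - y) \<ge> \<epsilon> \<longrightarrow>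
        norm ((1/2) *\<^sub>R (x + y)) \<le> 1 - \<delta>)"

text \<open>The library's \<open>euclidean_space\<close> would force the norm to come from an inner product.\<close>

definition finite_dimensional_space :: "'a::real_vector itself \<Rightarrow> bool" where
  "finite_dimensional_space _ \<longleftrightarrow> (\<exists>B::'a set. finite B \<and> span B = UNIV)"

text \<open>
  The dual of \<open>'a\<close> is \<open>'a \<Rightarrow>\<^sub>L real\<close> with the operator norm. On it the strong operator
  topology is the topology of pointwise convergence, i.e. the weak* topology.
\<close>

abbreviation weak_star_topology :: "('a::real_normed_vector \<Rightarrow>\<^sub>L real) topology" where
  "weak_star_topology \<equiv> strong_operator_topology"

text \<open>
  Directional derivatives live in the extended reals, so that the upper limit and the supremum
  are always meaningful; they are finite wherever \<open>f\<close> is Lipschitz near the point (resp. near the set,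
  with a common constant). The base point \<open>y\<close> ranges over full neighborhoods of \<open>x\<close>,
  with \<open>y = x\<close> allowed.
\<close>

definition clarke_derivative :: "('a::real_normed_vector \<Rightarrow> real) \<Rightarrow> 'a \<Rightarrow> 'a \<Rightarrow> ereal" where
  "clarke_derivative f x h =
     Limsup (nhds x \<times>\<^sub>F at_right 0) (\<lambda>(y, t). ereal ((f (y + t *\<^sub>R h) - f y) / t))"

definition clarke_gradient :: "('a::real_normed_vector \<Rightarrow> real) \<Rightarrow> 'a \<Rightarrow> ('a \<Rightarrow>\<^sub>L real) set" where
  "clarke_gradient f x = {a. \<forall>h. ereal (blinfun_apply a h) \<le> clarke_derivative f x h}"

definition gradient_on :: "('a::real_normed_vector \<Rightarrow> real) \<Rightarrow> 'a set \<Rightarrow> ('a \<Rightarrow>\<^sub>L real) set" where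
  "gradient_on f A =
     weak_star_topology closure_of (convex hull (\<Union>y\<in>A. clarke_gradient f y))"

definition derivative_on :: "('a::real_normed_vector \<Rightarrow> real) \<Rightarrow> 'a set \<Rightarrow> 'a \<Rightarrow> ereal" where
  "derivative_on f A h = (SUP y\<in>A. clarke_derivative f y h)"

definition descent_direction_on :: "('a::real_normed_vector \<Rightarrow> real) \<Rightarrow> 'a set \<Rightarrow> 'a \<Rightarrow> bool" where
  "descent_direction_on f A h \<longleftrightarrow> derivative_on f A h < 0"

end

theory Submission
  imports Defs
begin

text \<open>
  The least norm element \<open>a0\<close> has a unit vector \<open>h0\<close> with \<open>a0 h0 = - norm a0\<close>, and then
  \<open>a h0 \<le> - norm a0\<close> for all \<open>a\<close> in the gradient \<open>G\<close> on \<open>A\<close>: the points \<open>a\<^sub>t = a0 + t (a - a0)\<close> of \<open>G\<close>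
  have norm at least that of \<open>a0\<close>, which forces \<open>(a - a0) h\<^sub>t \<le> 0\<close> at their norming vectors \<open>h\<^sub>t\<close>,
  and \<open>h\<^sub>t\<close> tends to \<open>h0\<close> by uniform convexity. If \<open>a'\<close> in \<open>G\<close> is almost of least norm, then
  \<open>a' h0 \<le> - norm a0\<close> shows that \<open>h0\<close> almost norms \<open>a'\<close>, so uniform convexity puts \<open>h'\<close> close to \<open>h0\<close>.
  As \<open>G\<close> is bounded, \<open>a h'\<close> is then close to \<open>a h0\<close> uniformly in \<open>a\<close>.
\<close>

section \<open>The Hahn--Banach theorem for sublinear functionals\<close>

definition sublinear :: "('a::real_vector \<Rightarrow> real) \<Rightarrow> bool" where
  "sublinear p \<longleftrightarrow> (\<forall>x y. p (x + y) \<le> p x + p y) \<and> (\<forall>c x. 0 < c \<longrightarrow> p (c *\<^sub>R x) = c * p x)"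

lemma sublinear_add: "sublinear p \<Longrightarrow> p (x + y) \<le> p x + p y"
  by (simp add: sublinear_def)

lemma sublinear_scaleR: "sublinear p \<Longrightarrow> 0 < c \<Longrightarrow> p (c *\<^sub>R x) = c * p x"
  by (simp add: sublinear_def)

lemma sublinear_0: "sublinear p \<Longrightarrow> p 0 = 0"
  using sublinear_scaleR[of p 2 0] by simp

lemma sublinear_scaleR_nonneg: "sublinear p \<Longrightarrow> 0 \<le> c \<Longrightarrow> p (c *\<^sub>R x) = c * p x"
  by (cases "c = 0") (auto simp: sublinear_scaleR sublinear_0)

lemma sublinear_minus: "sublinear p \<Longrightarrow> - p (- x) \<le> p x"
  using sublinear_add[of p x "- x"] sublinear_0[of p] by simp

text \<open>The inequality for \<open>inverse c\<close> at the point \<open>c *\<^sub>R x\<close> is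
  the reverse inequality for \<open>c\<close>.\<close>

lemma sublinearI:
  assumes add: "\<And>x y. p (x + y) \<le> p x + p y"
    and scale: "\<And>c x. 0 < c \<Longrightarrow> p (c *\<^sub>R x) \<le> c * p x"
  shows "sublinear p"
  unfolding sublinear_def
proof (intro conjI allI impI)
  fix c :: real and x assume c: "0 < c"
  have "p (inverse c *\<^sub>R (c *\<^sub>R x)) \<le> inverse c * p (c *\<^sub>R x)"
    using c by (intro scale) simp
  then have "c * p x \<le> p (c *\<^sub>R x)"
    using c by (simp add: field_simps)
  with scale[OF c, of x] show "p (c *\<^sub>R x) = c * p x" by simp
qed (rule add)

text \<open>
  The shift is a sublinear functional below \<open>p\<close> that is at most \<open>- p v\<close> at \<open>- v\<close>; a minimal
  sublinear functional equals all its shifts, hence is additive.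
\<close>

definition sublinear_shift :: "('a::real_vector \<Rightarrow> real) \<Rightarrow> 'a \<Rightarrow> 'a \<Rightarrow> real" where
  "sublinear_shift p v x = (INF t\<in>{0..}. p (x + t *\<^sub>R v) - t * p v)"

lemma sublinear_shift_le:
  assumes p: "sublinear p" and t: "0 \<le> t"
  shows "sublinear_shift p v x \<le> p (x + t *\<^sub>R v) - t * p v"
  unfolding sublinear_shift_def
proof (rule cINF_lower)
  show "bdd_below ((\<lambda>t. p (x + t *\<^sub>R v) - t * p v) ` {0..})"
  proof (rule bdd_belowI2)
    fix t :: real assume "t \<in> {0..}"
    then show "- p (- x) \<le> p (x + t *\<^sub>R v) - t * p v"
      using sublinear_add[OF p, of "x + t *\<^sub>R v" "- x"] sublinear_scaleR_nonneg[OF p, of t v]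
      by simp
  qed
qed (use t in simp)

lemma sublinear_shift_greatest:
  assumes "\<And>t. 0 \<le> t \<Longrightarrow> c \<le> p (x + t *\<^sub>R v) - t * p v"
  shows "c \<le> sublinear_shift p v x"
  unfolding sublinear_shift_def by (rule cINF_greatest) (use assms in auto)

text \<open>Parameters \<open>s\<close> for \<open>x\<close> and \<open>t\<close> for
  \<open>y\<close> combine to the admissible parameter \<open>s + t\<close> for
  \<open>x + y\<close>; homogeneity comes from replacing \<open>t\<close> by
  \<open>c * t\<close>.\<close>

lemma sublinear_sublinear_shift:
  assumes p: "sublinear p"
  shows "sublinear (sublinear_shift p v)"
proof (rule sublinearI)
  fix x y
  have "sublinear_shift p v (x + y) - (p (y + t *\<^sub>R v) - t * p v) \<le> sublinear_shift p v x"
    if t: "0 \<le> t" for t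
  proof (rule sublinear_shift_greatest)
    fix s :: real assume s: "0 \<le> s"
    have "sublinear_shift p v (x + y) \<le> p (x + y + (s + t) *\<^sub>R v) - (s + t) * p v"
      using s t by (intro sublinear_shift_le p) simp
    also have "p (x + y + (s + t) *\<^sub>R v) \<le> p (x + s *\<^sub>R v) + p (y + t *\<^sub>R v)"
      using sublinear_add[OF p, of "x + s *\<^sub>R v" "y + t *\<^sub>R v"] by (simp add: algebra_simps)
    finally show "sublinear_shift p v (x + y) - (p (y + t *\<^sub>R v) - t * p v)
        \<le> p (x + s *\<^sub>R v) - s * p v"
      by (simp add: algebra_simps)
  qed
  then have "sublinear_shift p v (x + y) - sublinear_shift p v x \<le> sublinear_shift p v y"
    by (intro sublinear_shift_greatest) (simp add: algebra_simps)
  then show "sublinear_shift p v (x + y) \<le> sublinear_shift p v x + sublinear_shift p v y"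
    by simp
next
  fix c :: real and x assume c: "0 < c"
  have "inverse c * sublinear_shift p v (c *\<^sub>R x) \<le> sublinear_shift p v x"
  proof (rule sublinear_shift_greatest)
    fix t :: real assume t: "0 \<le> t"
    have "sublinear_shift p v (c *\<^sub>R x) \<le> p (c *\<^sub>R x + (c * t) *\<^sub>R v) - c * t * p v"
      using c t by (intro sublinear_shift_le p) simp
    also have "p (c *\<^sub>R x + (c * t) *\<^sub>R v) = c * p (x + t *\<^sub>R v)"
      using sublinear_scaleR[OF p c, of "x + t *\<^sub>R v"] by (simp add: algebra_simps)
    finally show "inverse c * sublinear_shift p v (c *\<^sub>R x) \<le> p (x + t *\<^sub>R v) - t * p v"
      using c by (simp add: field_simps)
  qed
  then show "sublinear_shift p v (c *\<^sub>R x) \<le> c * sublinear_shift p v x"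
    using c by (simp add: field_simps)
qed

text \<open>Zorn's lemma for the reversed pointwise order. The pointwise infimum bounds a chain from
  below; it is finite because every member satisfies \<open>- p (- x) \<le> q x\<close>.\<close>

lemma ex_minimal_sublinear:
  fixes p :: "'a::real_vector \<Rightarrow> real"
  assumes p: "sublinear p"
  obtains m where "sublinear m" "m \<le> p" "\<And>q. sublinear q \<Longrightarrow> q \<le> m \<Longrightarrow> q = m"
proof -
  let ?A = "{q. sublinear q \<and> q \<le> p}"
  have "\<exists>m\<in>?A. \<forall>q\<in>?A. m \<ge> q \<longrightarrow> q = m"
  proof (rule predicate_Zorn)
    show "partial_order_on ?A (relation_of (\<ge>) ?A)"
      by (rule partial_order_on_relation_ofI) auto
    fix C assume "C \<in> Chains (relation_of (\<ge>) ?A)"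
    then have CA: "C \<subseteq> ?A" and chain: "\<And>q r. q \<in> C \<Longrightarrow> r \<in> C \<Longrightarrow> q \<le> r \<or> r \<le> q"
      by (auto simp: Chains_def relation_of_def)
    show "\<exists>u\<in>?A. \<forall>q\<in>C. q \<ge> u"
    proof (cases "C = {}")
      case True
      with p show ?thesis by auto
    next
      case False
      define u where "u x = (INF q\<in>C. q x)" for x
      have lower: "u x \<le> q x" if "q \<in> C" for q x
        unfolding u_def
      proof (rule cINF_lower[OF _ that])
        show "bdd_below ((\<lambda>q. q x) ` C)"
        proof (rule bdd_belowI2)
          fix q assume "q \<in> C"
          then have "sublinear q" "q (- x) \<le> p (- x)"
            using CA by (auto simp: le_fun_def)
          then show "- p (- x) \<le> q x"
            using sublinear_minus[of q x] by simp
        qed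
      qed
      have greatest: "c \<le> u x" if "\<And>q. q \<in> C \<Longrightarrow> c \<le> q x" for c x
        unfolding u_def by (rule cINF_greatest[OF False that])
      have "sublinear u"
      proof (rule sublinearI)
        fix x y
        \<comment> \<open>Subadditivity of the infimum uses the chain property: of \<open>q\<close>
          and \<open>r\<close>, the smaller one is evaluated at both \<open>x\<close> and
          \<open>y\<close>.\<close>
        have *: "u (x + y) - r y \<le> u x" if r: "r \<in> C" for r
        proof (rule greatest)
          fix q assume q: "q \<in> C"
          show "u (x + y) - r y \<le> q x"
          proof (cases "q \<le> r")
            case True
            then show ?thesis
              using lower[OF q, of "x + y"] sublinear_add[of q x y] q CA le_funD[OF True, of y]
              by auto
          next
            case False
            then have "r \<le> q" using chain[OF q r] by blast
            then show ?thesis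
              using lower[OF r, of "x + y"] sublinear_add[of r x y] r CA le_funD[of r q x]
              by auto
          qed
        qed
        have "u (x + y) - u x \<le> u y"
          by (rule greatest) (use * in \<open>simp add: algebra_simps\<close>)
        then show "u (x + y) \<le> u x + u y" by simp
      next
        fix c :: real and x assume c: "0 < c"
        have "inverse c * u (c *\<^sub>R x) \<le> u x"
        proof (rule greatest)
          fix q assume q: "q \<in> C"
          then have "q (c *\<^sub>R x) = c * q x"
            using c CA by (auto intro: sublinear_scaleR)
          with lower[OF q, of "c *\<^sub>R x"] show "inverse c * u (c *\<^sub>R x) \<le> q x"
            using c by (simp add: field_simps)
        qed
        then show "u (c *\<^sub>R x) \<le> c * u x"
          using c by (simp add: field_simps)
      qed
      moreover have uq: "u \<le> q" if "q \<in> C" for q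
        using lower[OF that] by (simp add: le_fun_def)
      moreover have "u \<le> p"
      proof -
        obtain q where "q \<in> C" using False by blast
        with uq[of q] CA show ?thesis by auto
      qed
      ultimately show ?thesis by blast
    qed
  qed
  then show ?thesis
    using that by (metis (mono_tags, lifting) mem_Collect_eq order_trans)
qed

theorem hahn_banach_sublinear:
  fixes p :: "'a::real_vector \<Rightarrow> real"
  assumes p: "sublinear p"
  obtains g where "linear g" "\<And>x. g x \<le> p x" "g v = p v"
proof -
  obtain g where g: "sublinear g" "g \<le> sublinear_shift p v"
    and minimal: "\<And>q. sublinear q \<Longrightarrow> q \<le> g \<Longrightarrow> q = g"
    by (rule ex_minimal_sublinear[OF sublinear_sublinear_shift[OF p, of v]]) blast
  have gp: "g x \<le> p x" for x
    using le_funD[OF g(2), of x] sublinear_shift_le[OF p, of 0 v x] by simp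
  have add: "g (x + y) = g x + g y" for x y
  proof -
    have "sublinear_shift g y \<le> g"
      using sublinear_shift_le[OF g(1), of 0 y] by (simp add: le_fun_def)
    then have "sublinear_shift g y = g"
      by (intro minimal sublinear_sublinear_shift g)
    \<comment> \<open>The parameter \<open>1\<close> in the shift gives
      \<open>g x \<le> g (x + y) - g y\<close>, the reverse of subadditivity.\<close>
    with sublinear_shift_le[OF g(1), of 1 y x] sublinear_add[OF g(1), of x y]
    show ?thesis by simp
  qed
  have neg: "g (- x) = - g x" for x
    using add[of x "- x"] sublinear_0[OF g(1)] by simp
  have "g (c *\<^sub>R x) = c * g x" for c x
    using sublinear_scaleR_nonneg[OF g(1), of c x] sublinear_scaleR_nonneg[OF g(1), of "- c" x]
      neg[of "c *\<^sub>R x"] by (cases "0 \<le> c") auto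
  with add have "linear g" by (intro linearI) auto
  \<comment> \<open>The shift at \<open>- v\<close> with parameter \<open>1\<close> is at most
    \<open>p 0 - p v\<close>. This is what makes \<open>g\<close> touch \<open>p\<close> at
    \<open>v\<close>.\<close>
  moreover have "g (- v) \<le> - p v"
    using le_funD[OF g(2), of "- v"] sublinear_shift_le[OF p, of 1 v "- v"] sublinear_0[OF p]
    by simp
  with neg[of v] gp[of v] have "g v = p v" by simp
  ultimately show ?thesis using that gp by blast
qed

section \<open>The weak* topology\<close>

lemma compactin_pullback_topology:
  assumes "compactin T (f ` S)" "S \<subseteq> A"
  shows "compactin (pullback_topology A f T) S"
  unfolding compactin_def
proof (intro conjI allI impI)
  show "S \<subseteq> topspace (pullback_topology A f T)"
    using assms compactin_subset_topspace[OF assms(1)] by (auto simp: topspace_pullback_topology)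
  fix \<U> assume \<U>: "(\<forall>U\<in>\<U>. openin (pullback_topology A f T) U) \<and> S \<subseteq> \<Union>\<U>"
  then obtain g where g: "\<And>U. U \<in> \<U> \<Longrightarrow> openin T (g U) \<and> U = f -` g U \<inter> A"
    unfolding openin_pullback_topology by metis
  have "f ` S \<subseteq> \<Union>(g ` \<U>)"
    using \<U> g by blast
  then obtain \<F> where \<F>: "finite \<F>" "\<F> \<subseteq> g ` \<U>" "f ` S \<subseteq> \<Union>\<F>"
    using assms(1) g unfolding compactin_def by (metis (no_types, lifting) imageE)
  then obtain \<F>' where \<F>': "finite \<F>'" "\<F>' \<subseteq> \<U>" "\<F> = g ` \<F>'"
    by (meson finite_subset_image)
  have "S \<subseteq> \<Union>\<F>'"
    using \<F>(3) \<F>'(2,3) g assms(2) by blast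
  with \<F>' show "\<exists>\<F>. finite \<F> \<and> \<F> \<subseteq> \<U> \<and> S \<subseteq> \<Union>\<F>" by blast
qed

text \<open>Seen as functions, the ball is cut out by pointwise conditions only, which are suited to
  the product topology.\<close>

lemma blinfun_apply_image_cball:
  fixes r :: real
  assumes "0 \<le> r"
  shows "blinfun_apply ` cball 0 r =
    {g :: 'a::real_normed_vector \<Rightarrow> real. (\<forall>x. \<bar>g x\<bar> \<le> r * norm x) \<and>
       (\<forall>x y. g (x + y) = g x + g y) \<and> (\<forall>c x. g (c *\<^sub>R x) = c * g x)}"
proof (intro equalityI subsetI)
  fix g :: "'a \<Rightarrow> real" assume "g \<in> blinfun_apply ` cball 0 r"
  then obtain a where a: "norm a \<le> r" "g = blinfun_apply a" by auto
  have "\<bar>a x\<bar> \<le> r * norm x" for x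
    using norm_blinfun[of a x] mult_right_mono[OF a(1), of "norm x"] by simp
  then show "g \<in> {g. (\<forall>x. \<bar>g x\<bar> \<le> r * norm x) \<and>
       (\<forall>x y. g (x + y) = g x + g y) \<and> (\<forall>c x. g (c *\<^sub>R x) = c * g x)}"
    using a(2) by (simp add: blinfun.add_right blinfun.scaleR_right)
next
  fix g :: "'a \<Rightarrow> real"
  assume "g \<in> {g. (\<forall>x. \<bar>g x\<bar> \<le> r * norm x) \<and>
       (\<forall>x y. g (x + y) = g x + g y) \<and> (\<forall>c x. g (c *\<^sub>R x) = c * g x)}"
  then have g: "\<And>x. \<bar>g x\<bar> \<le> r * norm x" "\<And>x y. g (x + y) = g x + g y"
      "\<And>c x. g (c *\<^sub>R x) = c * g x" by auto
  then have "bounded_linear g"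
    by (intro bounded_linear_intro[of _ r]) (auto simp: mult.commute)
  then have eq: "blinfun_apply (Blinfun g) = g" by (rule bounded_linear_Blinfun_apply)
  have "norm (Blinfun g) \<le> r"
    using assms g(1) by (intro norm_blinfun_bound) (auto simp: eq)
  with eq show "g \<in> blinfun_apply ` cball 0 r"
    by (metis image_eqI mem_cball_0)
qed

text \<open>The weak* topology is the pullback of the product topology along
  \<open>blinfun_apply\<close>. The image of the ball is a product of compact intervals, compact by
  Tychonoff, intersected with the closed set of linear functions.\<close>

theorem banach_alaoglu:
  fixes r :: real
  shows "compactin weak_star_topology (cball (0::'a::real_normed_vector \<Rightarrow>\<^sub>L real) r)"
proof (cases "0 \<le> r")
  case True
  let ?P = "PiE UNIV (\<lambda>x::'a. {- (r * norm x)..r * norm x})"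
  let ?C = "{g :: 'a \<Rightarrow> real. (\<forall>x y. g (x + y) = g x + g y) \<and> (\<forall>c x. g (c *\<^sub>R x) = c * g x)}"
  have "compactin (product_topology (\<lambda>_. euclideanreal) UNIV) ?P"
    by (subst compactin_PiE) auto
  then have "compact ?P"
    by (simp add: euclidean_product_topology)
  moreover have "closed ?C"
    by (intro closed_Collect_conj closed_Collect_all closed_Collect_eq continuous_intros
        continuous_on_product_coordinates)
  ultimately have "compact (?P \<inter> ?C)" by (rule compact_Int_closed)
  also have "?P \<inter> ?C = blinfun_apply ` cball 0 r"
    using True by (subst blinfun_apply_image_cball) (auto simp: abs_le_iff minus_le_iff)
  finally show ?thesis
    unfolding strong_operator_topology_def
    by (intro compactin_pullback_topology) auto
qed simp

lemma closedin_weak_star_Collect_le: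
  "closedin weak_star_topology {a. blinfun_apply a h \<le> (c::real)}"
proof -
  have "closedin weak_star_topology
      {a \<in> topspace weak_star_topology. blinfun_apply a h \<in> {..c}}"
    by (rule closedin_continuous_map_preimage[OF strong_operator_topology_continuous_evaluation])
      simp
  then show ?thesis by (simp add: strong_operator_topology_topspace)
qed

text \<open>The ball is the intersection of the half-spaces \<open>a h \<le> r * norm h\<close>;
  using \<open>h\<close> and \<open>- h\<close> together recovers the absolute value.\<close>

lemma closedin_weak_star_cball:
  "closedin weak_star_topology (cball (0::'a::real_normed_vector \<Rightarrow>\<^sub>L real) r)"
proof (cases "0 \<le> r")
  case True
  have "cball (0::'a \<Rightarrow>\<^sub>L real) r = (\<Inter>h. {a. blinfun_apply a h \<le> r * norm h})"
  proof (intro equalityI subsetI INT_I CollectI)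
    fix a :: "'a \<Rightarrow>\<^sub>L real" and h assume "a \<in> cball 0 r"
    then show "a h \<le> r * norm h"
      using norm_blinfun[of a h] mult_right_mono[of "norm a" r "norm h"] by simp
  next
    fix a :: "'a \<Rightarrow>\<^sub>L real" assume "a \<in> (\<Inter>h. {a. blinfun_apply a h \<le> r * norm h})"
    then have "a h \<le> r * norm h" "a (- h) \<le> r * norm (- h)" for h by blast+
    then have "norm (a h) \<le> r * norm h" for h
      by (simp add: blinfun.minus_right abs_le_iff)
    then show "a \<in> cball 0 r"
      using norm_blinfun_bound[OF True, of a] by simp
  qed
  then show ?thesis
    by (auto intro!: closedin_INT closedin_weak_star_Collect_le)
qed simp

text \<open>The parts of \<open>G\<close> in the balls of radius \<open>m + 1 / Suc n\<close> are
  nonempty, nested and weak* closed in the compact ball of radius \<open>m + 1\<close>, so they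
  share a point.\<close>

lemma weak_star_closed_attains_min_norm:
  fixes G :: "('a::real_normed_vector \<Rightarrow>\<^sub>L real) set"
  assumes G: "closedin weak_star_topology G" "G \<noteq> {}"
  obtains a where "a \<in> G" "\<And>b. b \<in> G \<Longrightarrow> norm a \<le> norm b"
proof -
  define m where "m = Inf (norm ` G)"
  have m: "m \<le> norm b" if "b \<in> G" for b
    unfolding m_def using that by (intro cINF_lower bdd_belowI2[of _ 0]) auto
  define C where "C n = G \<inter> cball 0 (m + 1 / Suc n)" for n
  let ?X = "subtopology weak_star_topology (cball (0::'a \<Rightarrow>\<^sub>L real) (m + 1))"
  have "(\<Inter>n. C n) \<noteq> {}"
  proof (rule compact_space_imp_nest)
    show "compact_space ?X"
      by (rule compact_space_subtopology[OF banach_alaoglu])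
    show "closedin ?X (C n)" for n
    proof (rule closedin_subset_topspace)
      show "closedin weak_star_topology (C n)"
        unfolding C_def by (intro closedin_Int G closedin_weak_star_cball)
      have "1 / real (Suc n) \<le> 1" by simp
      then show "C n \<subseteq> cball 0 (m + 1)"
        unfolding C_def by (intro le_infI2 subset_cball add_left_mono)
    qed
    show "C n \<noteq> {}" for n
    proof -
      have "m < m + 1 / Suc n" by simp
      then obtain a where "a \<in> G" "norm a < m + 1 / Suc n"
        using cInf_lessD[of "norm ` G" "m + 1 / Suc n"] G(2) unfolding m_def by blast
      then show ?thesis unfolding C_def by (force simp del: of_nat_Suc)
    qed
    show "decseq C"
      unfolding decseq_def C_def
    proof (intro allI impI Int_mono order_refl)
      fix k n :: nat assume "k \<le> n"
      then have "1 / real (Suc n) \<le> 1 / real (Suc k)" by (simp add: frac_le)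
      then show "cball (0::'a \<Rightarrow>\<^sub>L real) (m + 1 / real (Suc n)) \<subseteq> cball 0 (m + 1 / real (Suc k))"
        by (intro subset_cball) simp
    qed
  qed
  then obtain a where a: "\<And>n. a \<in> C n" by blast
  have "norm a \<le> m"
  proof (rule LIMSEQ_le_const)
    show "(\<lambda>n. m + 1 / real (Suc n)) \<longlonglongrightarrow> m"
      using tendsto_add[OF tendsto_const LIMSEQ_Suc[OF lim_1_over_n], of m] by simp
    show "\<exists>N. \<forall>n\<ge>N. norm a \<le> m + 1 / real (Suc n)"
      using a unfolding C_def by auto
  qed
  with m a show ?thesis
    using that[of a] unfolding C_def by force
qed

lemma weak_star_bounded_closed_attains_max:
  fixes G :: "('a::real_normed_vector \<Rightarrow>\<^sub>L real) set"
  assumes G: "closedin weak_star_topology G" "G \<noteq> {}" and K: "\<And>a. a \<in> G \<Longrightarrow> norm a \<le> K"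
  obtains a where "a \<in> G" "\<And>b. b \<in> G \<Longrightarrow> b h \<le> a h"
proof -
  have "compactin weak_star_topology G"
    using closed_compactin[OF banach_alaoglu[of K] _ G(1)] K by (force simp: subset_eq)
  then have "compactin euclidean ((\<lambda>a. blinfun_apply a h) ` G)"
    by (rule image_compactin[OF _ strong_operator_topology_continuous_evaluation])
  then have "compact ((\<lambda>a. blinfun_apply a h) ` G)" by simp
  then show ?thesis
    using compact_attains_sup[of "(\<lambda>a. blinfun_apply a h) ` G"] G(2) that by auto
qed

lemma continuous_map_weak_star_affine:
  "continuous_map weak_star_topology weak_star_topology (\<lambda>a. u *\<^sub>R a + c)"
proof (subst continuous_on_strong_operator_topo_iff_coordinatewise, intro allI)
  fix x :: 'a
  have "continuous_map weak_star_topology euclideanreal (\<lambda>a. u * blinfun_apply a x + blinfun_apply c x)"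
    by (intro continuous_intros strong_operator_topology_continuous_evaluation)
  then show "continuous_map weak_star_topology euclidean (\<lambda>a. blinfun_apply (u *\<^sub>R a + c) x)"
    by (simp add: blinfun.add_left blinfun.scaleR_left)
qed

text \<open>The two points are moved into the closure one after the other, so that continuity of
  affine maps in a single variable suffices: \<open>aff\<close> is applied first to \<open>a\<close>
  against a fixed point of \<open>C\<close>, then to \<open>b\<close> against the fixed
  \<open>a\<close>.\<close>

lemma convex_weak_star_closure_of:
  fixes C :: "('a::real_normed_vector \<Rightarrow>\<^sub>L real) set"
  assumes C: "convex C"
  shows "convex (weak_star_topology closure_of C)"
proof -
  let ?G = "weak_star_topology closure_of C"
  have aff: "u *\<^sub>R a + c \<in> ?G"
    if a: "a \<in> ?G" and into: "\<And>x. x \<in> C \<Longrightarrow> u *\<^sub>R x + c \<in> ?G" for u a c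
  proof -
    have "u *\<^sub>R a + c \<in> weak_star_topology closure_of ((\<lambda>x. u *\<^sub>R x + c) ` C)"
      using continuous_map_image_closure_subset[OF continuous_map_weak_star_affine] a by blast
    also have "\<dots> \<subseteq> ?G"
      using into by (intro closure_of_minimal) auto
    finally show ?thesis .
  qed
  have sub: "C \<subseteq> ?G"
    by (intro closure_of_subset) (simp add: strong_operator_topology_topspace)
  show ?thesis
  proof (rule convexI)
    fix a b :: "'a \<Rightarrow>\<^sub>L real" and u v :: real
    assume ab: "a \<in> ?G" "b \<in> ?G" and uv: "0 \<le> u" "0 \<le> v" "u + v = 1"
    have "u *\<^sub>R a + v *\<^sub>R y \<in> ?G" if "y \<in> C" for y
      by (rule aff[OF ab(1)]) (use that C uv sub in \<open>auto dest: convexD\<close>)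
    then show "u *\<^sub>R a + v *\<^sub>R b \<in> ?G"
      using aff[OF ab(2), of v "u *\<^sub>R a"] by (simp add: add.commute)
  qed
qed

text \<open>A half-space given by evaluation at \<open>h\<close> is both convex and weak*
  closed.\<close>

lemma weak_star_closure_hull_le:
  assumes "a \<in> weak_star_topology closure_of (convex hull S)"
    and "\<And>b. b \<in> S \<Longrightarrow> blinfun_apply b h \<le> (c::real)"
  shows "blinfun_apply a h \<le> c"
proof -
  have "convex {b. blinfun_apply b h \<le> c}"
  proof (rule convexI, rule CollectI)
    fix x y :: "'a \<Rightarrow>\<^sub>L real" and u v :: real
    assume "x \<in> {b. blinfun_apply b h \<le> c}" "y \<in> {b. blinfun_apply b h \<le> c}"
      "0 \<le> u" "0 \<le> v" "u + v = 1"
    then show "blinfun_apply (u *\<^sub>R x + v *\<^sub>R y) h \<le> c"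
      using convex_bound_le[of "x h" c "y h" u v] by (simp add: blinfun.add_left blinfun.scaleR_left)
  qed
  then have "convex hull S \<subseteq> {b. blinfun_apply b h \<le> c}"
    using assms(2) by (intro hull_minimal) auto
  then have "weak_star_topology closure_of (convex hull S) \<subseteq> {b. blinfun_apply b h \<le> c}"
    by (intro closure_of_minimal closedin_weak_star_Collect_le)
  with assms(1) show ?thesis by blast
qed

section \<open>Uniform convexity and norming vectors\<close>

lemma ex_unit_blinfun_gt:
  fixes a :: "'a::real_normed_vector \<Rightarrow>\<^sub>L real"
  assumes "a \<noteq> 0" "c < norm a"
  obtains x where "norm x = 1" "c < a x"
proof -
  \<comment> \<open>A bound on the operator norm has to be nonnegative, hence the maximum with
    0.\<close>
  have "max c 0 < norm a" using assms by simp
  then have "\<not> (\<forall>x. norm (a x) \<le> max c 0 * norm x)"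
    using norm_blinfun_bound[of "max c 0" a] by (metis max.cobounded2 not_le)
  then obtain x where x: "max c 0 * norm x < norm (a x)" by (auto simp: not_le)
  then have nz: "x \<noteq> 0" by auto
  define y where "y = (sgn (a x) / norm x) *\<^sub>R x"
  have ax: "a x \<noteq> 0" using x by (auto simp: mult_less_0_iff)
  have "norm y = 1" using nz ax by (simp add: y_def abs_sgn_eq)
  moreover have "a y = \<bar>a x\<bar> / norm x"
    by (simp add: y_def blinfun.scaleR_right sgn_mult_abs abs_sgn mult.commute)
  then have "max c 0 < a y" using x nz by (metis pos_less_divide_eq zero_less_norm_iff real_norm_def)
  ultimately show ?thesis using that[of y] by simp
qed

text \<open>If \<open>x\<close> and \<open>y\<close> were far apart, \<open>norm (x + y)\<close>
  would be at most \<open>2 - 2 * \<delta>\<close>, too small for \<open>a\<close> to be nearly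
  normed by both. The constant \<open>\<eta>\<close> depends on \<open>\<epsilon>\<close> alone,
  which later gives uniformity over all functionals.\<close>

lemma uniformly_convex_norming:
  assumes "uniformly_convex_space TYPE('a::real_normed_vector)" "0 < \<epsilon>"
  obtains \<eta> where "0 < \<eta>"
    "\<And>(a::'a \<Rightarrow>\<^sub>L real) x y. norm x = 1 \<Longrightarrow> norm y = 1 \<Longrightarrow>
       (2 - \<eta>) * norm a < blinfun_apply a x + blinfun_apply a y \<Longrightarrow> norm (x - y) < \<epsilon>"
proof -
  obtain \<delta> where \<delta>: "0 < \<delta>"
    "\<And>(x::'a) y. norm x = 1 \<Longrightarrow> norm y = 1 \<Longrightarrow> norm (x - y) \<ge> \<epsilon> \<Longrightarrow>
       norm ((1/2) *\<^sub>R (x + y)) \<le> 1 - \<delta>"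
    using assms unfolding uniformly_convex_space_def by metis
  show ?thesis
  proof (rule that[of "2 * \<delta>"])
    fix a :: "'a \<Rightarrow>\<^sub>L real" and x y :: 'a
    assume xy: "norm x = 1" "norm y = 1" "(2 - 2 * \<delta>) * norm a < blinfun_apply a x + blinfun_apply a y"
    show "norm (x - y) < \<epsilon>"
    proof (rule ccontr)
      assume "\<not> norm (x - y) < \<epsilon>"
      then have "norm (x + y) \<le> 2 - 2 * \<delta>" using \<delta>(2)[of x y] xy by simp
      then have "norm a * norm (x + y) \<le> norm a * (2 - 2 * \<delta>)"
        by (rule mult_left_mono) simp
      with norm_blinfun[of a "x + y"] xy(3) show False
        by (simp add: blinfun.add_right mult.commute)
    qed
  qed (use \<delta> in simp)
qed

text \<open>The previous estimate for \<open>- a\<close>, which takes exactly the value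
  \<open>norm a\<close> at \<open>h\<close>.\<close>

lemma norming_vector_stable:
  assumes "uniformly_convex_space TYPE('a::real_normed_vector)" "0 < \<epsilon>"
  obtains \<eta> where "0 < \<eta>"
    "\<And>(a::'a \<Rightarrow>\<^sub>L real) h k. blinfun_apply a h = - norm a \<Longrightarrow> norm h = 1 \<Longrightarrow> norm k = 1 \<Longrightarrow>
       blinfun_apply a k < - ((1 - \<eta>) * norm a) \<Longrightarrow> norm (h - k) < \<epsilon>"
proof -
  obtain \<eta> where \<eta>: "0 < \<eta>"
    "\<And>(a::'a \<Rightarrow>\<^sub>L real) x y. norm x = 1 \<Longrightarrow> norm y = 1 \<Longrightarrow>
       (2 - \<eta>) * norm a < blinfun_apply a x + blinfun_apply a y \<Longrightarrow> norm (x - y) < \<epsilon>"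
    using uniformly_convex_norming[OF assms] by metis
  show ?thesis
  proof (rule that[OF \<eta>(1)])
    fix a :: "'a \<Rightarrow>\<^sub>L real" and h k
    assume "a h = - norm a" "norm h = 1" "norm k = 1" "a k < - ((1 - \<eta>) * norm a)"
    then show "norm (h - k) < \<epsilon>"
      by (intro \<eta>(2)[of _ _ "- a"]) (simp_all add: blinfun.minus_left algebra_simps)
  qed
qed

text \<open>A maximizing sequence of unit vectors is Cauchy by uniform convexity, and its limit
  attains the norm by completeness. Uniqueness holds because two norming vectors are closer than
  every positive \<open>e\<close>.\<close>

lemma ex1_norming_vector:
  fixes a :: "'a::banach \<Rightarrow>\<^sub>L real"
  assumes uc: "uniformly_convex_space TYPE('a)" and nz: "a \<noteq> 0"
  shows "\<exists>!h. a h = - norm a \<and> norm h = 1"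
proof (rule ex_ex1I)
  have "\<exists>x. norm x = 1 \<and> norm a * (1 - 1 / real (Suc n)) < a x" for n
  proof -
    have "norm a * (1 - 1 / real (Suc n)) < norm a * 1"
      using nz by (intro mult_strict_left_mono) auto
    then show ?thesis
      using ex_unit_blinfun_gt[OF nz, of "norm a * (1 - 1 / real (Suc n))"] by auto
  qed
  then obtain x where x: "\<And>n. norm (x n) = 1" "\<And>n. norm a * (1 - 1 / real (Suc n)) < a (x n)"
    by metis
  have "Cauchy x"
    unfolding Cauchy_iff
  proof (intro allI impI)
    fix e :: real assume "0 < e"
    then obtain \<eta> where \<eta>: "0 < \<eta>"
      "\<And>(a::'a \<Rightarrow>\<^sub>L real) x y. norm x = 1 \<Longrightarrow> norm y = 1 \<Longrightarrow>
       (2 - \<eta>) * norm a < blinfun_apply a x + blinfun_apply a y \<Longrightarrow> norm (x - y) < e"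
      using uniformly_convex_norming[OF uc] by metis
    \<comment> \<open>Half of \<open>\<eta>\<close> for each of the two members of the sequence that
      are compared.\<close>
    obtain M where M: "1 / real (Suc M) < \<eta> / 2"
      using reals_Archimedean[of "\<eta> / 2"] \<eta>(1) by (auto simp: inverse_eq_divide)
    have large: "norm a * (1 - \<eta> / 2) < a (x n)" if "n \<ge> M" for n
    proof -
      have "1 / real (Suc n) \<le> 1 / real (Suc M)" using that by (simp add: frac_le)
      then have "norm a * (1 - \<eta> / 2) \<le> norm a * (1 - 1 / real (Suc n))"
        using M by (intro mult_left_mono) auto
      with x(2)[of n] show ?thesis by simp
    qed
    have "norm (x m - x n) < e" if "m \<ge> M" "n \<ge> M" for m n
      using large[OF that(1)] large[OF that(2)]
      by (intro \<eta>(2)[of _ _ a] x) (simp add: algebra_simps)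
    then show "\<exists>M. \<forall>m\<ge>M. \<forall>n\<ge>M. norm (x m - x n) < e" by blast
  qed
  then obtain l where l: "x \<longlonglongrightarrow> l"
    using Cauchy_convergent_iff convergent_def by blast
  have nl: "norm l = 1"
    using tendsto_norm[OF l] x(1) by (simp add: LIMSEQ_const_iff)
  have "(\<lambda>n. norm a * (1 - 1 / real (Suc n))) \<longlonglongrightarrow> norm a * (1 - 0)"
    by (intro tendsto_intros LIMSEQ_Suc lim_1_over_n)
  moreover have "(\<lambda>n. a (x n)) \<longlonglongrightarrow> a l" by (intro tendsto_intros l)
  ultimately have "norm a \<le> a l"
    using x(2) by (intro LIMSEQ_le[of "\<lambda>n. norm a * (1 - 1 / real (Suc n))"]) (auto intro: less_imp_le)
  moreover have "a l \<le> norm a"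
    using norm_blinfun[of a l] nl by simp
  ultimately show "\<exists>h. a h = - norm a \<and> norm h = 1"
    using nl by (intro exI[of _ "- l"]) (simp add: blinfun.minus_right)
next
  fix h k assume h: "a h = - norm a \<and> norm h = 1" and k: "a k = - norm a \<and> norm k = 1"
  have "norm (h - k) < e" if e: "0 < e" for e
  proof -
    obtain \<eta> where \<eta>: "0 < \<eta>"
      "\<And>(a::'a \<Rightarrow>\<^sub>L real) h k. blinfun_apply a h = - norm a \<Longrightarrow> norm h = 1 \<Longrightarrow> norm k = 1 \<Longrightarrow>
       blinfun_apply a k < - ((1 - \<eta>) * norm a) \<Longrightarrow> norm (h - k) < e"
      using norming_vector_stable[OF uc e] by metis
    then show ?thesis using h k nz by (intro \<eta>(2)[of a]) auto
  qed
  then show "h = k" by (metis less_irrefl right_minus_eq zero_less_norm_iff)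
qed

text \<open>The vector \<open>h0\<close> defines a hyperplane separating \<open>G\<close> from the
  open ball of radius \<open>norm a0\<close>, so the separating functional on the dual is evaluation
  at a point of the space itself.\<close>

lemma convex_min_norm_norming_vector:
  fixes a0 :: "'a::banach \<Rightarrow>\<^sub>L real"
  assumes uc: "uniformly_convex_space TYPE('a)"
    and G: "convex G" "a0 \<in> G" "a0 \<noteq> 0" and min: "\<And>b. b \<in> G \<Longrightarrow> norm a0 \<le> norm b"
    and h0: "a0 h0 = - norm a0" "norm h0 = 1" and a: "a \<in> G"
  shows "a h0 \<le> - norm a0"
proof -
  let ?D = "norm (a - a0)"
  have "(a - a0) h0 \<le> ?D * e" if e: "0 < e" for e
  proof -
    obtain \<eta> where \<eta>: "0 < \<eta>"
      "\<And>(a::'a \<Rightarrow>\<^sub>L real) h k. blinfun_apply a h = - norm a \<Longrightarrow> norm h = 1 \<Longrightarrow> norm k = 1 \<Longrightarrow>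
       blinfun_apply a k < - ((1 - \<eta>) * norm a) \<Longrightarrow> norm (h - k) < e"
      using norming_vector_stable[OF uc e] by metis
    \<comment> \<open>The bound 1 keeps \<open>b\<close> on the segment inside \<open>G\<close>. The
      other bound makes the perturbation \<open>t * ?D\<close> smaller than
      \<open>\<eta> * norm a0\<close>; the summand 1 keeps the denominator positive and the
      inequality strict.\<close>
    define t where "t = min 1 (\<eta> * norm a0 / (?D + 1))"
    have t: "0 < t" "t \<le> 1"
      using \<eta> G by (auto simp: t_def intro!: divide_pos_pos add_nonneg_pos)
    have "t * (?D + 1) \<le> \<eta> * norm a0"
      by (metis t_def min.cobounded2 pos_le_divide_eq add_nonneg_pos norm_ge_zero zero_less_one)
    with t have tD: "t * ?D < \<eta> * norm a0" by (simp add: algebra_simps)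
    define b where "b = a0 + t *\<^sub>R (a - a0)"
    have "b = (1 - t) *\<^sub>R a0 + t *\<^sub>R a" by (simp add: b_def algebra_simps)
    then have "b \<in> G" using G a t by (simp add: convexD)
    then have b: "norm a0 \<le> norm b" by (rule min)
    then have "b \<noteq> 0" using G by auto
    then obtain k where k: "b k = - norm b" "norm k = 1"
      using ex1_norming_vector[OF uc] by blast
    have bk: "b k = a0 k + t * (a - a0) k"
      by (simp add: b_def blinfun.add_left blinfun.scaleR_left)
    have a0k: "- norm a0 \<le> a0 k"
      using norm_blinfun[of a0 k] k by (simp add: abs_le_iff)
    have Dk: "- ?D \<le> (a - a0) k"
      using norm_blinfun[of "a - a0" k] k by (simp add: abs_le_iff)
    have "t * - ?D \<le> t * (a - a0) k"
      using Dk t by (intro mult_left_mono) auto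
    \<comment> \<open>Since \<open>- a0 k = norm b + t * (a - a0) k\<close>, this value is at least
      \<open>norm a0 - t * ?D\<close>.\<close>
    then have "a0 k < - ((1 - \<eta>) * norm a0)"
      using bk k(1) b tD by (simp add: algebra_simps)
    then have "norm (h0 - k) < e"
      using \<eta>(2)[of a0 h0 k] h0 k by simp
    then have "?D * norm (h0 - k) \<le> ?D * e" by (intro mult_left_mono) auto
    then have "(a - a0) (h0 - k) \<le> ?D * e"
      using norm_blinfun[of "a - a0" "h0 - k"] by simp
    \<comment> \<open>Minimality enters here:
      \<open>norm a0 \<le> norm b = - a0 k - t * (a - a0) k\<close>, and \<open>- a0 k\<close> is at
      most \<open>norm a0\<close>.\<close>
    moreover have "t * (a - a0) k \<le> 0" using bk k(1) b a0k by simp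
    then have "(a - a0) k \<le> 0" using t by (simp add: mult_le_0_iff)
    ultimately show ?thesis by (simp add: blinfun.diff_right)
  qed
  note le = this
  have "(a - a0) h0 \<le> 0 + e" if e: "0 < e" for e
  proof -
    have D: "0 < ?D + 1" by (simp add: add_nonneg_pos)
    \<comment> \<open>Rescaling \<open>e\<close> absorbs the factor \<open>?D\<close>, which may be
      zero.\<close>
    have "(a - a0) h0 \<le> ?D * (e / (?D + 1))"
      using D e by (intro le) simp
    also have "\<dots> \<le> (?D + 1) * (e / (?D + 1))"
      using D e by (intro mult_right_mono) auto
    also have "\<dots> = 0 + e" using D by simp
    finally show ?thesis .
  qed
  then have "(a - a0) h0 \<le> 0" by (rule field_le_epsilon)
  then show ?thesis using h0 by (simp add: blinfun.diff_left)
qed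

text \<open>At \<open>h0\<close> every functional of \<open>G\<close> is at most
  \<open>- norm a0\<close>. Passing from \<open>h0\<close> to \<open>h\<close> costs at most
  \<open>K * norm (h - h0)\<close>, which must fit into the slack
  \<open>(1 - \<delta>) * norm a0\<close>.\<close>

lemma almost_min_norm_norming_vector:
  fixes a0 :: "'a::banach \<Rightarrow>\<^sub>L real"
  assumes uc: "uniformly_convex_space TYPE('a)"
    and G: "convex G" "a0 \<in> G" "a0 \<noteq> 0" and min: "\<And>b. b \<in> G \<Longrightarrow> norm a0 \<le> norm b"
    and K: "\<And>b. b \<in> G \<Longrightarrow> norm b \<le> K" and \<delta>: "\<delta> < 1"
  obtains \<tau> where "0 < \<tau>"
    "\<And>b h a. \<lbrakk>b \<in> G; norm b \<le> norm a0 + \<tau>; blinfun_apply b h = - norm b; norm h = 1; a \<in> G\<rbrakk> \<Longrightarrow>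
       blinfun_apply a h < - \<delta> * norm a0"
proof -
  obtain h0 where h0: "a0 h0 = - norm a0" "norm h0 = 1"
    using ex1_norming_vector[OF uc G(3)] by blast
  have K0: "0 \<le> K" using K[OF G(2)] norm_ge_zero[of a0] by linarith
  \<comment> \<open>With \<open>K + 1\<close> in the denominator, \<open>K * e\<close> stays
    strictly below the slack, also for \<open>K = 0\<close>.\<close>
  define e where "e = (1 - \<delta>) * norm a0 / (K + 1)"
  have e: "0 < e" using K0 \<delta> G by (simp add: e_def)
  have "(K + 1) * e = (1 - \<delta>) * norm a0" using K0 by (simp add: e_def)
  with e have Ke: "K * e < (1 - \<delta>) * norm a0" by (simp add: algebra_simps)
  obtain \<eta> where \<eta>: "0 < \<eta>"
    "\<And>(a::'a \<Rightarrow>\<^sub>L real) h k. blinfun_apply a h = - norm a \<Longrightarrow> norm h = 1 \<Longrightarrow> norm k = 1 \<Longrightarrow>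
       blinfun_apply a k < - ((1 - \<eta>) * norm a) \<Longrightarrow> norm (h - k) < e"
    using norming_vector_stable[OF uc e] by metis
  show ?thesis
  \<comment> \<open>This \<open>\<tau>\<close> works because
    \<open>(1 - \<eta>) * (1 + \<eta>) < 1\<close>: then \<open>(1 - \<eta>) * norm b\<close> is
    below \<open>norm a0\<close>, so \<open>h0\<close> nearly norms \<open>b\<close>.\<close>
  proof (rule that[of "\<eta> * norm a0"])
    show "0 < \<eta> * norm a0" using \<eta> G by simp
    fix b h a assume b: "b \<in> G" "norm b \<le> norm a0 + \<eta> * norm a0"
      and h: "b h = - norm b" "norm h = 1" and a: "a \<in> G"
    have le: "blinfun_apply c h0 \<le> - norm a0" if "c \<in> G" for c
      by (rule convex_min_norm_norming_vector[OF uc G min h0 that])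
    have "(1 - \<eta>) * norm b < norm a0"
    proof (cases "\<eta> \<le> 1")
      case True
      then have "(1 - \<eta>) * norm b \<le> (1 - \<eta>) * (norm a0 + \<eta> * norm a0)"
        using b by (intro mult_left_mono) auto
      also have "\<dots> = norm a0 - \<eta> * \<eta> * norm a0" by (simp add: algebra_simps)
      also have "\<dots> < norm a0" using \<eta> G by simp
      finally show ?thesis .
    next
      case False
      then have "(1 - \<eta>) * norm b \<le> 0" by (simp add: mult_le_0_iff)
      then show ?thesis using G by (meson le_less_trans zero_less_norm_iff)
    qed
    with le[OF b(1)] have "norm (h - h0) < e"
      using h h0 by (intro \<eta>(2)[of b]) auto
    then have "norm a * norm (h - h0) \<le> K * e"
      using K[OF a] K0 by (intro mult_mono) auto
    then have "a (h - h0) \<le> K * e"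
      using norm_blinfun[of a "h - h0"] by simp
    with le[OF a] Ke show "a h < - \<delta> * norm a0"
      by (simp add: blinfun.diff_right algebra_simps)
  qed
qed

text \<open>The midpoint of two distinct points of equal norm would have smaller norm; strict
  convexity speaks of unit vectors, so both points are normalized first.\<close>

lemma strictly_convex_min_norm_unique:
  fixes G :: "'a::real_normed_vector set"
  assumes sc: "strictly_convex_space TYPE('a)" and G: "convex G" "a \<in> G" "b \<in> G"
    and min: "\<And>c. c \<in> G \<Longrightarrow> norm a \<le> norm c" "\<And>c. c \<in> G \<Longrightarrow> norm b \<le> norm c"
  shows "a = b"
proof (rule ccontr)
  assume ne: "a \<noteq> b"
  have eq: "norm b = norm a" using min G by (simp add: antisym)
  have nz: "norm a \<noteq> 0" using eq ne by auto
  have "sgn a \<noteq> sgn b"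
    using ne nz eq by (simp add: sgn_div_norm)
  then have "norm ((1 - 1/2) *\<^sub>R sgn a + (1/2) *\<^sub>R sgn b) < 1"
    using nz eq by (intro sc[unfolded strictly_convex_space_def, rule_format]) (auto simp: norm_sgn)
  also have "(1 - 1/2) *\<^sub>R sgn a + (1/2) *\<^sub>R sgn b = ((1/2) *\<^sub>R a + (1/2) *\<^sub>R b) /\<^sub>R norm a"
    by (simp add: sgn_div_norm eq scaleR_add_right mult.commute)
  finally have "norm ((1/2) *\<^sub>R a + (1/2) *\<^sub>R b) < norm a"
    using nz by (simp only: norm_scaleR) (simp add: divide_simps)
  moreover have "(1/2) *\<^sub>R a + (1/2) *\<^sub>R b \<in> G"
    using G by (intro convexD) auto
  ultimately show False using min(1) by fastforce
qed

section \<open>Finite-dimensional spaces: from strict to uniform convexity\<close>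

text \<open>Induction on the spanning set, for all radii at once. A new vector \<open>b\<close> has
  positive distance \<open>d\<close> from the old span, which bounds the coefficient of
  \<open>b\<close> and then the remaining summand; the set is thus a closed part of a continuous
  image of a compact set.\<close>

lemma compact_span_Int_cball:
  fixes B :: "'a::real_normed_vector set"
  assumes "finite B"
  shows "compact (span B \<inter> cball 0 r)"
  using assms
proof (induction B arbitrary: r rule: finite_induct)
  case empty
  have "span {} \<inter> cball 0 r = (if 0 \<le> r then {0::'a} else {})" by auto
  then show ?case by simp
next
  case (insert b B)
  show ?case
  proof (cases "b \<in> span B")
    case True
    then show ?thesis by (simp add: span_redundant insert.IH)
  next
    case False
    \<comment> \<open>Only this bounded part of the span is known to be closed. Points of the span
      outside it have distance more than 1 from \<open>b\<close>, which explains the minimum with 1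
      in \<open>d\<close>.\<close>
    have closed: "closed (span B \<inter> cball 0 (2 * norm b + 1))"
      by (intro compact_imp_closed insert.IH)
    obtain d' where d': "0 < d'"
        "\<And>s. s \<in> span B \<inter> cball 0 (2 * norm b + 1) \<Longrightarrow> d' \<le> dist b s"
    proof -
      obtain e where "0 < e" "ball b e \<subseteq> - (span B \<inter> cball 0 (2 * norm b + 1))"
        using closed False by (metis ComplI IntD1 open_Compl open_contains_ball)
      then show thesis by (intro that[of e]) (auto simp: not_le[symmetric] subset_eq)
    qed
    define d where "d = min d' 1"
    have d: "0 < d" using d' by (simp add: d_def)
    have dist: "d \<le> norm (b - s)" if "s \<in> span B" for s
    proof (cases "norm s \<le> 2 * norm b + 1")
      case True
      then show ?thesis using d'(2)[of s] that by (simp add: d_def dist_norm)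
    next
      case False
      then show ?thesis using norm_triangle_ineq2[of s b] norm_ge_zero[of b]
        by (simp add: d_def norm_minus_commute del: norm_ge_zero)
    qed
    define R where "R = r + \<bar>r / d\<bar> * norm b"
    let ?K = "(\<lambda>(t, s). s + t *\<^sub>R b) ` ({- \<bar>r / d\<bar>..\<bar>r / d\<bar>} \<times> (span B \<inter> cball 0 R))"
    have "compact ?K"
      unfolding case_prod_unfold
      by (intro compact_continuous_image continuous_intros compact_Times insert.IH compact_Icc)
    then have "compact (?K \<inter> cball 0 r)" by (intro compact_Int_closed) auto
    also have "?K \<inter> cball 0 r = span (insert b B) \<inter> cball 0 r"
    proof (intro equalityI subsetI)
      fix x assume "x \<in> ?K \<inter> cball 0 r"
      then obtain s t where "x = s + t *\<^sub>R b" "s \<in> span B" "x \<in> cball 0 r" by auto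
      then show "x \<in> span (insert b B) \<inter> cball 0 r"
        by (auto simp: span_insert intro!: exI[of _ t])
    next
      fix x assume x: "x \<in> span (insert b B) \<inter> cball 0 r"
      then obtain t where t: "x - t *\<^sub>R b \<in> span B" by (auto simp: span_insert)
      have nx: "norm x \<le> r" using x by simp
      have tb: "\<bar>t\<bar> \<le> \<bar>r / d\<bar>"
      proof (cases "t = 0")
        case False
        \<comment> \<open>This point differs from \<open>b\<close> by
          \<open>inverse t *\<^sub>R x\<close>, so the distance bound becomes
          \<open>d * \<bar>t\<bar> \<le> norm x\<close>.\<close>
        have "- (inverse t *\<^sub>R (x - t *\<^sub>R b)) \<in> span B"
          by (intro span_neg span_scale t)
        from dist[OF this] have "d \<le> norm (inverse t *\<^sub>R x)"
          using False by (simp add: algebra_simps)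
        then have "\<bar>t\<bar> * d \<le> norm x" using False by (simp add: field_simps)
        with nx d show ?thesis by (simp add: pos_le_divide_eq)
      qed simp
      have "norm (x - t *\<^sub>R b) \<le> norm x + \<bar>t\<bar> * norm b"
        using norm_triangle_ineq4[of x "t *\<^sub>R b"] by simp
      also have "\<dots> \<le> R"
        unfolding R_def using nx tb by (intro add_mono mult_right_mono) auto
      finally have "(t, x - t *\<^sub>R b) \<in> {- \<bar>r / d\<bar>..\<bar>r / d\<bar>} \<times> (span B \<inter> cball 0 R)"
        using t tb by (auto simp: abs_le_iff)
      then show "x \<in> ?K \<inter> cball 0 r"
        using x by (auto intro!: rev_image_eqI)
    qed
    finally show ?thesis .
  qed
qed

text \<open>On the compact set of pairs of unit vectors at distance at least
  \<open>\<epsilon>\<close>, the norm of the midpoint attains its maximum, which strict convexity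
  puts below 1; the gap is the modulus.\<close>

lemma finite_dimensional_strictly_convex_imp_uniformly_convex:
  assumes "finite_dimensional_space TYPE('a::real_normed_vector)"
    and sc: "strictly_convex_space TYPE('a)"
  shows "uniformly_convex_space TYPE('a)"
  unfolding uniformly_convex_space_def
proof (intro allI impI)
  fix \<epsilon> :: real assume \<epsilon>: "0 < \<epsilon>"
  obtain B :: "'a set" where "finite B" "span B = UNIV"
    using assms(1) unfolding finite_dimensional_space_def by blast
  then have "compact (cball (0::'a) 1)"
    using compact_span_Int_cball[of B 1] by simp
  then have "compact (cball (0::'a) 1 \<inter> sphere 0 1)"
    by (rule compact_Int_closed) (simp add: sphere_def closed_Collect_eq continuous_intros)
  also have "cball (0::'a) 1 \<inter> sphere 0 1 = sphere 0 1" by auto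
  finally have sphere: "compact (sphere (0::'a) 1)" .
  define K where "K = (sphere (0::'a) 1 \<times> sphere 0 1) \<inter> {z. \<epsilon> \<le> norm (fst z - snd z)}"
  have "compact K"
    unfolding K_def
    by (intro compact_Int_closed compact_Times sphere closed_Collect_le continuous_intros)
  show "\<exists>\<delta>>0. \<forall>x y::'a. norm x = 1 \<longrightarrow> norm y = 1 \<longrightarrow> \<epsilon> \<le> norm (x - y) \<longrightarrow>
      norm ((1/2) *\<^sub>R (x + y)) \<le> 1 - \<delta>"
  proof (cases "K = {}")
    case True
    \<comment> \<open>No pair is that far apart, so any positive modulus will do.\<close>
    then show ?thesis by (intro exI[of _ 1]) (force simp: K_def)
  next
    case False
    have "continuous_on K (\<lambda>z. norm ((1/2) *\<^sub>R (fst z + snd z)))"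
      by (intro continuous_intros)
    from continuous_attains_sup[OF \<open>compact K\<close> False this] obtain z where z: "z \<in> K"
      "\<And>w. w \<in> K \<Longrightarrow> norm ((1/2) *\<^sub>R (fst w + snd w)) \<le> norm ((1/2) *\<^sub>R (fst z + snd z))"
      by blast
    have "norm ((1 - 1/2) *\<^sub>R fst z + (1/2) *\<^sub>R snd z) < 1"
      using z(1) \<epsilon> by (intro sc[unfolded strictly_convex_space_def, rule_format]) (auto simp: K_def)
    then have lt: "norm ((1/2) *\<^sub>R (fst z + snd z)) < 1"
      by (simp add: scaleR_add_right)
    show ?thesis
    proof (intro exI[of _ "1 - norm ((1/2) *\<^sub>R (fst z + snd z))"] conjI allI impI)
      fix x y :: 'a assume "norm x = 1" "norm y = 1" "\<epsilon> \<le> norm (x - y)"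
      then show "norm ((1/2) *\<^sub>R (x + y)) \<le> 1 - (1 - norm ((1/2) *\<^sub>R (fst z + snd z)))"
        using z(2)[of "(x, y)"] by (simp add: K_def)
    qed (use lt in simp)
  qed
qed

section \<open>Clarke's generalized gradient\<close>

text \<open>The upper limit ranges over all nearby base points, so \<open>y + t *\<^sub>R h\<close>
  may serve as a base point as well.\<close>

lemma filterlim_shifted_base_point:
  fixes x h :: "'a::real_normed_vector"
  shows "filterlim (\<lambda>(y, t). y + t *\<^sub>R h) (nhds x) (nhds x \<times>\<^sub>F at_right 0)"
proof -
  have "((\<lambda>z. fst z + snd z *\<^sub>R h) \<longlongrightarrow> x + 0 *\<^sub>R h) (nhds x \<times>\<^sub>F at_right (0::real))"
    by (intro tendsto_intros filterlim_fst
        filterlim_compose[OF filterlim_ident[THEN filterlim_mono, OF at_within_le_nhds order_refl] filterlim_snd])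
  then show ?thesis by (simp add: case_prod_unfold)
qed

lemma eventually_step_pos:
  "eventually (\<lambda>(y, t). 0 < t) (nhds x \<times>\<^sub>F at_right (0::real))"
  using eventually_compose_filterlim[OF eventually_at_right_less filterlim_snd]
  by (simp add: case_prod_unfold)

text \<open>Replaces the extended real upper limit by eventual strict inequalities between reals,
  which can be added and reparametrized.\<close>

lemma clarke_derivative_le_iff:
  "clarke_derivative f x h \<le> ereal c \<longleftrightarrow>
     (\<forall>e>0. eventually (\<lambda>(y, t). (f (y + t *\<^sub>R h) - f y) / t < c + e) (nhds x \<times>\<^sub>F at_right 0))"
  (is "?L \<longleftrightarrow> ?R")
proof
  assume le: ?L
  show ?R
  proof (intro allI impI)
    fix e :: real assume "0 < e"
    then have "clarke_derivative f x h < ereal (c + e)"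
      using le by (auto intro: le_less_trans)
    then show "eventually (\<lambda>(y, t). (f (y + t *\<^sub>R h) - f y) / t < c + e) (nhds x \<times>\<^sub>F at_right 0)"
      unfolding clarke_derivative_def by (auto dest!: Limsup_lessD simp: case_prod_unfold)
  qed
next
  assume ev: ?R
  show ?L
  proof (rule ereal_le_epsilon2)
    fix e :: real assume "0 < e"
    then have "eventually (\<lambda>(y, t). (f (y + t *\<^sub>R h) - f y) / t < c + e) (nhds x \<times>\<^sub>F at_right 0)"
      using ev by blast
    then show "clarke_derivative f x h \<le> ereal c + ereal e"
      unfolding clarke_derivative_def
      by (intro Limsup_bounded) (auto elim: eventually_mono)
  qed
qed

lemma abs_clarke_derivative_le:
  fixes x :: "'a::real_normed_vector"
  assumes U: "open U" "x \<in> U" and f: "L-lipschitz_on U f"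
  shows "\<bar>clarke_derivative f x h\<bar> \<le> ereal (L * norm h)"
proof -
  let ?F = "nhds x \<times>\<^sub>F at_right (0::real)"
  have "eventually (\<lambda>z. fst z \<in> U) ?F" "eventually (\<lambda>(y, t). y + t *\<^sub>R h \<in> U) ?F"
    using eventually_compose_filterlim[OF eventually_nhds_in_open[OF U] filterlim_fst]
      eventually_compose_filterlim[OF eventually_nhds_in_open[OF U] filterlim_shifted_base_point]
    by (auto simp: case_prod_unfold)
  with eventually_step_pos[of x]
  have ev: "eventually (\<lambda>(y, t). - (L * norm h) \<le> (f (y + t *\<^sub>R h) - f y) / t \<and>
      (f (y + t *\<^sub>R h) - f y) / t \<le> L * norm h) ?F"
  proof eventually_elim
    case (elim z)
    then have "\<bar>f (fst z + snd z *\<^sub>R h) - f (fst z)\<bar> \<le> L * norm (snd z *\<^sub>R h)"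
      using lipschitz_onD[OF f, of "fst z + snd z *\<^sub>R h" "fst z"]
      by (auto simp: dist_norm case_prod_unfold)
    with elim have "\<bar>(f (fst z + snd z *\<^sub>R h) - f (fst z)) / snd z\<bar> \<le> L * norm h"
      by (auto simp: case_prod_unfold field_simps)
    from abs_le_D1[OF this] abs_le_D2[OF this] show ?case by (simp add: case_prod_unfold)
  qed
  \<comment> \<open>A lower bound for an upper limit requires a nontrivial filter.\<close>
  have "?F \<noteq> bot" by (simp add: prod_filter_eq_bot)
  then have "ereal (- (L * norm h)) \<le> clarke_derivative f x h"
    unfolding clarke_derivative_def
    by (rule le_Limsup) (use ev in \<open>auto elim!: eventually_mono\<close>)
  moreover have "clarke_derivative f x h \<le> ereal (L * norm h)"
    unfolding clarke_derivative_def
    by (rule Limsup_bounded) (use ev in \<open>auto elim!: eventually_mono\<close>)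
  ultimately show ?thesis
    by (cases "clarke_derivative f x h") auto
qed

lemma clarke_derivative_le_norm:
  fixes x :: "'a::real_normed_vector"
  assumes "open U" "x \<in> U" "L-lipschitz_on U f"
  shows "clarke_derivative f x h \<le> ereal (L * norm h)"
  using abs_clarke_derivative_le[OF assms, of h] by (cases "clarke_derivative f x h") auto

text \<open>The Lipschitz bound makes the derivative finite, so passing to reals loses nothing.
  Sublinearity is what Hahn--Banach needs.\<close>

lemma
  fixes x :: "'a::real_normed_vector"
  assumes U: "open U" "x \<in> U" and f: "L-lipschitz_on U f"
  shows ereal_real_clarke_derivative:
      "ereal (real_of_ereal (clarke_derivative f x h)) = clarke_derivative f x h"
    and sublinear_clarke_derivative: "sublinear (\<lambda>h. real_of_ereal (clarke_derivative f x h))"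
proof -
  let ?F = "nhds x \<times>\<^sub>F at_right (0::real)"
  let ?p = "\<lambda>h. real_of_ereal (clarke_derivative f x h)"
  show eq: "ereal (?p h) = clarke_derivative f x h" for h
    using abs_clarke_derivative_le[OF assms, of h] by (intro ereal_real') auto
  have ev: "eventually (\<lambda>(y, t). (f (y + t *\<^sub>R h) - f y) / t < ?p h + e) ?F" if "0 < e" for h e
    using clarke_derivative_le_iff[of f x h "?p h", unfolded eq] that by blast
  have le: "?p h \<le> c" if "\<And>e. 0 < e \<Longrightarrow> eventually (\<lambda>(y, t). (f (y + t *\<^sub>R h) - f y) / t < c + e) ?F"
    for h c
  proof -
    have "ereal (?p h) \<le> ereal c"
      unfolding eq clarke_derivative_le_iff using that by blast
    then show ?thesis by simp
  qed
  show "sublinear ?p"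
  proof (rule sublinearI)
    fix h k
    show "?p (h + k) \<le> ?p h + ?p k"
    proof (rule le)
      fix e :: real assume e: "0 < e"
      \<comment> \<open>The increment along \<open>h + k\<close> is split at
        \<open>y + t *\<^sub>R h\<close>; the second piece is a quotient in direction
        \<open>k\<close> with this moving base point.\<close>
      have "filterlim (\<lambda>(y, t). (y + t *\<^sub>R h, t)) ?F ?F"
        using filterlim_Pair[OF filterlim_shifted_base_point[of h x] filterlim_snd]
        by (simp add: case_prod_unfold)
      from eventually_compose_filterlim[OF ev[of "e/2" k] this]
      have "eventually (\<lambda>(y, t). (f (y + t *\<^sub>R h + t *\<^sub>R k) - f (y + t *\<^sub>R h)) / t < ?p k + e/2) ?F"
        using e by (simp add: case_prod_unfold)
      moreover have "eventually (\<lambda>(y, t). (f (y + t *\<^sub>R h) - f y) / t < ?p h + e/2) ?F"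
        using ev e by simp
      ultimately
      show "eventually (\<lambda>(y, t). (f (y + t *\<^sub>R (h + k)) - f y) / t < ?p h + ?p k + e) ?F"
        by eventually_elim
          (auto simp: case_prod_unfold scaleR_add_right add.assoc diff_divide_distrib)
    qed
  next
    fix c :: real and h assume c: "0 < c"
    show "?p (c *\<^sub>R h) \<le> c * ?p h"
    proof (rule le)
      fix e :: real assume e: "0 < e"
      \<comment> \<open>A step \<open>t\<close> along \<open>c *\<^sub>R h\<close> is a step
        \<open>c * t\<close> along \<open>h\<close>.\<close>
      have "filterlim (\<lambda>t. c * t) (at_right 0) (at_right 0)"
        using c by (intro filterlim_times_pos[OF filterlim_ident]) auto
      from filterlim_Pair[OF filterlim_fst filterlim_compose[OF this filterlim_snd]]
      have "filterlim (\<lambda>(y, t). (y, c * t)) ?F ?F"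
        by (simp add: case_prod_unfold)
      from eventually_compose_filterlim[OF ev[of "e / c" h] this]
      have "eventually (\<lambda>(y, t). (f (y + (c * t) *\<^sub>R h) - f y) / (c * t) < ?p h + e / c) ?F"
        using c e by (simp add: case_prod_unfold)
      with eventually_step_pos[of x]
      show "eventually (\<lambda>(y, t). (f (y + t *\<^sub>R c *\<^sub>R h) - f y) / t < c * ?p h + e) ?F"
      proof eventually_elim
        case (elim z)
        obtain y t where z: "z = (y, t)" by fastforce
        have "c * ((f (y + (c * t) *\<^sub>R h) - f y) / (c * t)) < c * (?p h + e / c)"
          using elim c by (intro mult_strict_left_mono) (auto simp: z)
        then show ?case using c by (simp add: z distrib_left mult.commute)
      qed
    qed
  qed
qed

text \<open>Hahn--Banach gives a linear functional below the derivative that touches it at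
  \<open>h\<close>, and the Lipschitz bound makes it continuous. Hence the derivative is the support
  function of the gradient.\<close>

lemma clarke_gradient_attains_derivative:
  fixes x :: "'a::real_normed_vector"
  assumes U: "open U" "x \<in> U" and f: "L-lipschitz_on U f"
  obtains a where "a \<in> clarke_gradient f x" "ereal (blinfun_apply a h) = clarke_derivative f x h"
proof -
  let ?p = "\<lambda>h. real_of_ereal (clarke_derivative f x h)"
  obtain g where g: "linear g" "\<And>k. g k \<le> ?p k" "g h = ?p h"
    using hahn_banach_sublinear[OF sublinear_clarke_derivative[OF assms], of h] by blast
  have bound: "g k \<le> L * norm k" for k
  proof -
    have "ereal (?p k) \<le> ereal (L * norm k)"
      unfolding ereal_real_clarke_derivative[OF assms] by (rule clarke_derivative_le_norm[OF assms])
    with g(2)[of k] show ?thesis by simp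
  qed
  have "bounded_linear g"
  proof (rule bounded_linear_intro)
    show "norm (g k) \<le> norm k * L" for k
      using bound[of k] bound[of "- k"] linear_neg[OF g(1), of k] by (simp add: abs_le_iff mult.commute)
  qed (use g(1) in \<open>auto simp: linear_add linear_scale\<close>)
  then have "blinfun_apply (Blinfun g) = g" by (rule bounded_linear_Blinfun_apply)
  moreover have "ereal (g k) \<le> clarke_derivative f x k" for k
    using g(2)[of k] by (metis ereal_less_eq(3) ereal_real_clarke_derivative[OF assms])
  ultimately show ?thesis
    using that[of "Blinfun g"] g(3) ereal_real_clarke_derivative[OF assms, of h]
    by (simp add: clarke_gradient_def)
qed

lemma clarke_gradient_norm_le:
  fixes x :: "'a::real_normed_vector"
  assumes U: "open U" "x \<in> U" and f: "L-lipschitz_on U f" and a: "a \<in> clarke_gradient f x"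
  shows "norm a \<le> L"
proof (rule norm_blinfun_bound)
  show "0 \<le> L" by (rule lipschitz_on_nonneg[OF f])
  have bound: "blinfun_apply a k \<le> L * norm k" for k
  proof -
    have "ereal (blinfun_apply a k) \<le> clarke_derivative f x k"
      using a by (simp add: clarke_gradient_def)
    also have "\<dots> \<le> ereal (L * norm k)" by (rule clarke_derivative_le_norm[OF U f])
    finally show ?thesis by simp
  qed
  show "norm (blinfun_apply a h) \<le> L * norm h" for h
    using bound[of h] bound[of "- h"] by (simp add: abs_le_iff blinfun.minus_right)
qed

section \<open>Gradient and directional derivative on a set\<close>

lemma clarke_gradient_subset_gradient_on:
  "y \<in> A \<Longrightarrow> clarke_gradient f y \<subseteq> gradient_on f A"
proof -
  assume "y \<in> A"
  then have "clarke_gradient f y \<subseteq> convex hull (\<Union>y\<in>A. clarke_gradient f y)"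
    using hull_subset by fastforce
  also have "\<dots> \<subseteq> gradient_on f A"
    unfolding gradient_on_def
    by (intro closure_of_subset) (simp add: strong_operator_topology_topspace)
  finally show ?thesis .
qed

lemma closedin_gradient_on: "closedin weak_star_topology (gradient_on f A)"
  by (simp add: gradient_on_def)

lemma convex_gradient_on: "convex (gradient_on f A)"
  unfolding gradient_on_def by (intro convex_weak_star_closure_of convex_convex_hull)

context
  fixes f :: "'a::real_normed_vector \<Rightarrow> real" and A U :: "'a set" and L :: real
  assumes U: "open U" "A \<subseteq> U" and f: "L-lipschitz_on U f"
begin

lemma gradient_on_nonempty: "A \<noteq> {} \<Longrightarrow> gradient_on f A \<noteq> {}"
proof -
  assume "A \<noteq> {}"
  then obtain y where y: "y \<in> A" by blast
  then obtain a where "a \<in> clarke_gradient f y"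
    using clarke_gradient_attains_derivative[OF U(1) subsetD[OF U(2)] f, of y 0] by metis
  with clarke_gradient_subset_gradient_on[OF y] show ?thesis by blast
qed

text \<open>The ball of radius \<open>L\<close> is convex and weak* closed, so the pointwise bound
  survives hull and closure. It makes the gradient on \<open>A\<close> weak* compact and supplies
  the constant \<open>K\<close> above.\<close>

lemma gradient_on_norm_le:
  assumes a: "a \<in> gradient_on f A"
  shows "norm a \<le> L"
proof -
  have "(\<Union>y\<in>A. clarke_gradient f y) \<subseteq> cball 0 L"
    using clarke_gradient_norm_le[OF U(1) _ f] U(2) by auto
  then have "convex hull (\<Union>y\<in>A. clarke_gradient f y) \<subseteq> cball 0 L"
    by (intro hull_minimal convex_cball)
  then have "gradient_on f A \<subseteq> cball 0 L"
    unfolding gradient_on_def by (intro closure_of_minimal closedin_weak_star_cball)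
  with a show ?thesis by auto
qed

lemma gradient_on_le_derivative_on:
  assumes a: "a \<in> gradient_on f A"
  shows "ereal (blinfun_apply a h) \<le> derivative_on f A h"
\<comment> \<open>Half-spaces have real bounds while the supremum is an extended real, so it is
  approached by larger values.\<close>
proof (rule dense_ge)
  have le: "ereal (blinfun_apply b h) \<le> derivative_on f A h"
    if "b \<in> (\<Union>y\<in>A. clarke_gradient f y)" for b
    using that unfolding derivative_on_def clarke_gradient_def
    by (auto intro: SUP_upper2)
  fix s assume s: "derivative_on f A h < s"
  show "ereal (blinfun_apply a h) \<le> s"
  proof (cases s)
    case (real c)
    have "blinfun_apply a h \<le> c"
      using a unfolding gradient_on_def
      by (rule weak_star_closure_hull_le) (use le s real in \<open>fastforce dest: le_less_trans\<close>)
    with real show ?thesis by simp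
  next
    case MInf
    with s show ?thesis by simp
  qed simp
qed

text \<open>The maximum exists by weak* compactness. It dominates every
  \<open>clarke_derivative f y h\<close>, since that value is taken by some functional in the
  gradient at \<open>y\<close>.\<close>

lemma gradient_on_attains_derivative_on:
  assumes "A \<noteq> {}"
  obtains a where "is_arg_max (\<lambda>b. blinfun_apply b h) (\<lambda>b. b \<in> gradient_on f A) a"
    "ereal (blinfun_apply a h) = derivative_on f A h"
proof -
  obtain a where a: "a \<in> gradient_on f A"
    and max: "\<And>b. b \<in> gradient_on f A \<Longrightarrow> blinfun_apply b h \<le> blinfun_apply a h"
    by (rule weak_star_bounded_closed_attains_max[OF closedin_gradient_on
          gradient_on_nonempty[OF assms] gradient_on_norm_le, of h]) blast+
  have "derivative_on f A h \<le> ereal (blinfun_apply a h)"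
    unfolding derivative_on_def
  proof (rule SUP_least)
    fix y assume y: "y \<in> A"
    then obtain b where b: "b \<in> clarke_gradient f y"
        "ereal (blinfun_apply b h) = clarke_derivative f y h"
      using clarke_gradient_attains_derivative[OF U(1) subsetD[OF U(2) y] f, of h] by metis
    then have "blinfun_apply b h \<le> blinfun_apply a h"
      using clarke_gradient_subset_gradient_on[OF y] by (blast intro: max)
    with b(2) show "clarke_derivative f y h \<le> ereal (blinfun_apply a h)"
      by (metis ereal_less_eq(3))
  qed
  with gradient_on_le_derivative_on[OF a, of h] have "ereal (blinfun_apply a h) = derivative_on f A h"
    by (rule antisym)
  moreover have "is_arg_max (\<lambda>b. blinfun_apply b h) (\<lambda>b. b \<in> gradient_on f A) a"
    using a max by (auto simp: is_arg_max_linorder)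
  ultimately show ?thesis using that by blast
qed

end

text \<open>The neighborhood of \<open>A\<close> is \<open>N\<close>, with the open set
  \<open>U\<close> as witness. Existence and uniqueness of the least norm element and of
  \<open>h'\<close>, and the attained maximum, are part of the conclusion.\<close>

theorem corollary3p16:
  fixes f :: "'a::banach \<Rightarrow> real" and A U N :: "'a set" and L :: real
  assumes "uniformly_convex_space TYPE('a) \<or>
           finite_dimensional_space TYPE('a) \<and> strictly_convex_space TYPE('a)"
    and "strictly_convex_space TYPE('a \<Rightarrow>\<^sub>L real)"
    and "A \<noteq> {}"
    and "open U" and "A \<subseteq> U" and "U \<subseteq> N" and "L-lipschitz_on N f"
    and "0 \<notin> gradient_on f A"
  shows "(\<exists>!a0. is_arg_min norm (\<lambda>a. a \<in> gradient_on f A) a0) \<and>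
    (\<forall>a0. is_arg_min norm (\<lambda>a. a \<in> gradient_on f A) a0 \<longrightarrow>
      (\<forall>\<delta>::real. 0 < \<delta> \<and> \<delta> < 1 \<longrightarrow>
        (\<exists>\<tau>>0. \<forall>a'\<in>gradient_on f A. norm a' \<le> norm a0 + \<tau> \<longrightarrow>
          (\<exists>!h'. blinfun_apply a' h' = - norm a' \<and> norm h' = 1) \<and>
          (\<forall>h'. blinfun_apply a' h' = - norm a' \<and> norm h' = 1 \<longrightarrow>
            descent_direction_on f A h' \<and>
            (\<exists>a. is_arg_max (\<lambda>b. blinfun_apply b h') (\<lambda>b. b \<in> gradient_on f A) a \<and>
                 ereal (blinfun_apply a h') = derivative_on f A h') \<and>
            derivative_on f A h' < ereal (- \<delta> * norm a0)))))"
proof -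
  let ?G = "gradient_on f A"
  \<comment> \<open>Both alternatives on the space are reduced to uniform convexity.\<close>
  have uc: "uniformly_convex_space TYPE('a)"
    using assms(1) finite_dimensional_strictly_convex_imp_uniformly_convex by blast
  have f: "L-lipschitz_on U f"
    using assms(6,7) by (rule lipschitz_on_subset[rotated])
  note U = assms(4,5)
  have arg_min: "is_arg_min norm (\<lambda>a. a \<in> ?G) a0 \<longleftrightarrow> a0 \<in> ?G \<and> (\<forall>b\<in>?G. norm a0 \<le> norm b)" for a0
    by (auto simp: is_arg_min_linorder)
  show ?thesis
  proof (intro conjI allI impI)
    show "\<exists>!a0. is_arg_min norm (\<lambda>a. a \<in> ?G) a0"
      unfolding arg_min
    proof (rule ex_ex1I)
      show "\<exists>a0. a0 \<in> ?G \<and> (\<forall>b\<in>?G. norm a0 \<le> norm b)"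
        using weak_star_closed_attains_min_norm[OF closedin_gradient_on gradient_on_nonempty[OF U f assms(3)]]
        by metis
      show "a = b" if "a \<in> ?G \<and> (\<forall>c\<in>?G. norm a \<le> norm c)"
        "b \<in> ?G \<and> (\<forall>c\<in>?G. norm b \<le> norm c)" for a b
        using that by (intro strictly_convex_min_norm_unique[OF assms(2) convex_gradient_on]) auto
    qed
  next
    fix a0 and \<delta> :: real
    assume a0: "is_arg_min norm (\<lambda>a. a \<in> ?G) a0" and \<delta>: "0 < \<delta> \<and> \<delta> < 1"
    have min: "a0 \<in> ?G" "\<And>b. b \<in> ?G \<Longrightarrow> norm a0 \<le> norm b"
      using a0 by (auto simp: arg_min)
    then have "a0 \<noteq> 0" using assms(8) by auto
    from almost_min_norm_norming_vector[OF uc convex_gradient_on min(1) this min(2)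
        gradient_on_norm_le[OF U f] conjunct2[OF \<delta>]]
    obtain \<tau> where \<tau>: "0 < \<tau>"
      "\<And>b h a. \<lbrakk>b \<in> ?G; norm b \<le> norm a0 + \<tau>; blinfun_apply b h = - norm b; norm h = 1; a \<in> ?G\<rbrakk>
        \<Longrightarrow> blinfun_apply a h < - \<delta> * norm a0"
      by blast
    show "\<exists>\<tau>>0. \<forall>a'\<in>?G. norm a' \<le> norm a0 + \<tau> \<longrightarrow>
          (\<exists>!h'. blinfun_apply a' h' = - norm a' \<and> norm h' = 1) \<and>
          (\<forall>h'. blinfun_apply a' h' = - norm a' \<and> norm h' = 1 \<longrightarrow>
            descent_direction_on f A h' \<and>
            (\<exists>a. is_arg_max (\<lambda>b. blinfun_apply b h') (\<lambda>b. b \<in> ?G) a \<and>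
                 ereal (blinfun_apply a h') = derivative_on f A h') \<and>
            derivative_on f A h' < ereal (- \<delta> * norm a0))"
    proof (rule exI[of _ \<tau>], rule conjI[OF \<tau>(1)], intro ballI impI, rule conjI, goal_cases)
      case (1 a')
      then have "a' \<noteq> 0" using assms(8) by auto
      then show ?case by (rule ex1_norming_vector[OF uc])
    next
      case (2 a')
      show ?case
      proof (intro allI impI)
        fix h' assume h': "blinfun_apply a' h' = - norm a' \<and> norm h' = 1"
        \<comment> \<open>As the derivative on \<open>A\<close> is attained at a functional of the
          gradient, the strict estimate for single functionals stays strict for the
          supremum.\<close>
        obtain a where a: "is_arg_max (\<lambda>b. blinfun_apply b h') (\<lambda>b. b \<in> ?G) a"
          "ereal (blinfun_apply a h') = derivative_on f A h'"
          using gradient_on_attains_derivative_on[OF U f assms(3)] by metis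
        have "a \<in> ?G" using a(1) by (simp add: is_arg_max_def)
        then have "blinfun_apply a h' < - \<delta> * norm a0"
          using \<tau>(2)[of a' h' a] 2 h' by blast
        then have less: "derivative_on f A h' < ereal (- \<delta> * norm a0)"
          by (simp flip: a(2))
        also have "\<dots> \<le> 0" using \<delta> by simp
        finally have "descent_direction_on f A h'"
          unfolding descent_direction_on_def .
        with a less show "descent_direction_on f A h' \<and>
            (\<exists>a. is_arg_max (\<lambda>b. blinfun_apply b h') (\<lambda>b. b \<in> ?G) a \<and>
                 ereal (blinfun_apply a h') = derivative_on f A h') \<and>
            derivative_on f A h' < ereal (- \<delta> * norm a0)"
          by blast
      qed
    qed
  qed
qed

end
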